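(* Let $P\subseteq\mathbb{R}^d$ be a rational $d$-polytope with codenominator $r$. (a) Let $m\in\mathbb{Z}_{>0}$ be such that $\frac mrP$ is a lattice polytope. If $\frac mr$ is an integer, then the $\operatorname{h}^*_{\mathbb{Z}}$-polynomial of $P$ can be retrieved from the $\operatorname{h}^*_{\mathbb{Q}}$-polynomial by applying the operator $\operatorname{Int}$: $\operatorname{h}^*_{\mathbb{Z}}(P;t)=\operatorname{Int}\left(\operatorname{h}^*_{\mathbb{Q}}(P;t;m)\right)$. (b) Let $m\in\mathbb{Z}_{>0}$ be such that $\frac m{2r}P$ is a lattice polytope. If $\frac m{2r}$ is an integer, then the $\operatorname{h}^*_{\mathbb{Z}}$-polynomial of $P$ can be retrieved from the $\operatorname{h}^{*\mathsf{ref}}_{\mathbb{Q}}$-polynomial by applying the operator $\operatorname{Int}$: $\operatorname{h}^*_{\mathbb{Z}}(P;t)=\operatorname{Int}\left(\operatorname{h}^{*\mathsf{ref}}_{\mathbb{Q}}(P;t;m)\right)$.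
   Context: A rational (resp. lattice) polytope is the convex hull of finitely many points of $\mathbb{Q}^d$ (resp. $\mathbb{Z}^d$); a $d$-polytope is a $d$-dimensional polytope in $\mathbb{R}^d$. The denominator of a rational polytope $P$ is the smallest positive integer $k$ such that $kP$ is a lattice polytope. Codenominator: write a rational $d$-polytope $P$ by its irredundant halfspace description $P=\{\mathbf{x}\in\mathbb{R}^d:\mathbf{A}\mathbf{x}\le\mathbf{b}\}$ with $\mathbf{A}\in\mathbb{Z}^{n\times d}$, $\mathbf{b}\in\mathbb{Z}^n$, such that for every $i$ the greatest common divisor of $b_i$ and the entries of the $i$th row of $\mathbf{A}$ is $1$; the codenominator of $P$ is the (positive) least common multiple $r$ of the nonzero entries of $\mathbf{b}$. The (integral) Ehrhart series of $P$ is $\operatorname{Ehr}_{\mathbb{Z}}(P;t)=1+\sum_{n\in\mathbb{Z}_{>0}}|nP\cap\mathbb{Z}^d|\,t^n$, and $\operatorname{h}^*_{\mathbb{Z}}(P;t)\in\mathbb{Z}[t]$ is the polynomial defined by $\operatorname{Ehr}_{\mathbb{Z}}(P;t)=\operatorname{h}^*_{\mathbb{Z}}(P;t)/(1-t^k)^{d+1}$, where $k$ is the denominator of $P$. Put $\operatorname{ehr}_{\mathbb{Q}}(P;\lambda)=|\lambda P\cap\mathbb{Z}^d|$ for rational $\lambda$. The rational and refined rational Ehrhart series are $\operatorname{Ehr}_{\mathbb{Q}}(P;t)=1+\sum_{n\in\mathbb{Z}_{>0}}\operatorname{ehr}_{\mathbb{Q}}(P;\frac nr)\,t^{\frac nr}$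 and $\operatorname{Ehr}^{\mathsf{ref}}_{\mathbb{Q}}(P;t)=1+\sum_{n\in\mathbb{Z}_{>0}}\operatorname{ehr}_{\mathbb{Q}}(P;\frac n{2r})\,t^{\frac n{2r}}$. If $m\in\mathbb{Z}_{>0}$ and $\frac mrP$ (resp. $\frac m{2r}P$) is a lattice polytope, then $\operatorname{h}^*_{\mathbb{Q}}(P;t;m)\in\mathbb{Z}[t^{1/r}]$ (resp. $\operatorname{h}^{*\mathsf{ref}}_{\mathbb{Q}}(P;t;m)\in\mathbb{Z}[t^{1/(2r)}]$) is the polynomial defined by $\operatorname{Ehr}_{\mathbb{Q}}(P;t)=\operatorname{h}^*_{\mathbb{Q}}(P;t;m)/(1-t^{m/r})^{d+1}$ (resp. $\operatorname{Ehr}^{\mathsf{ref}}_{\mathbb{Q}}(P;t)=\operatorname{h}^{*\mathsf{ref}}_{\mathbb{Q}}(P;t;m)/(1-t^{m/(2r)})^{d+1}$). The operator $\operatorname{Int}$ extracts from a polynomial in $\mathbb{Z}[t^{1/r}]$ (resp. $\mathbb{Z}[t^{1/(2r)}]$) the terms with integer powers of $t$.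
   Formalization: The equations are asserted only when m/r (resp. m/(2r)) equals the denominator k of P, as they fail otherwise (P=[0,1], m=2 in (a)); for other m only the identity h*_Z/(1-t^k)^{d+1} = Int(h* )/(1-t^{m/r})^{d+1} (resp. with m/(2r)) is stated. *)

theory Defs
  imports "HOL-Analysis.Analysis" "HOL-Computational_Algebra.Computational_Algebra"
begin

definition rational_polytope :: "(real^'d) set \<Rightarrow> bool" where
  "rational_polytope P \<longleftrightarrow>
     (\<exists>V. finite V \<and> (\<forall>v\<in>V. \<forall>i. v $ i \<in> \<rat>) \<and> P = convex hull V)"

definition lattice_polytope :: "(real^'d) set \<Rightarrow> bool" where
  "lattice_polytope P \<longleftrightarrow>
     (\<exists>V. finite V \<and> (\<forall>v\<in>V. \<forall>i. v $ i \<in> \<int>) \<and> P = convex hull V)"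

definition dilate :: "real \<Rightarrow> (real^'d) set \<Rightarrow> (real^'d) set" where
  "dilate c P = (\<lambda>x. c *\<^sub>R x) ` P"

definition denominator :: "(real^'d) set \<Rightarrow> nat" where
  "denominator P = (LEAST k. k > 0 \<and> lattice_polytope (dilate (real k) P))"

text \<open>
  The set of solutions of those inequalities \<open>A\<^sub>i x \<le> b\<^sub>i\<close> whose index lies in \<open>I\<close>.
\<close>
definition halfspace_set :: "nat set \<Rightarrow> (nat \<Rightarrow> int^'d) \<Rightarrow> (nat \<Rightarrow> int) \<Rightarrow> (real^'d) set" where
  "halfspace_set I A b =
     {x. \<forall>i\<in>I. (\<Sum>j\<in>UNIV. real_of_int (A i $ j) * x $ j) \<le> real_of_int (b i)}"

text \<open>
  Irredundant integral halfspace description with \<open>n\<close> primitive rows; only the values of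
  \<open>A\<close> and \<open>b\<close> below \<open>n\<close> matter.
\<close>
definition halfspace_description ::
    "(real^'d) set \<Rightarrow> nat \<Rightarrow> (nat \<Rightarrow> int^'d) \<Rightarrow> (nat \<Rightarrow> int) \<Rightarrow> bool" where
  "halfspace_description P n A b \<longleftrightarrow>
     P = halfspace_set {..<n} A b \<and>
     (\<forall>i<n. halfspace_set ({..<n} - {i}) A b \<noteq> P) \<and>
     (\<forall>i<n. Gcd (insert (b i) (range (\<lambda>j. A i $ j))) = 1)"

text \<open>
  A relation rather than a function: for a full-dimensional rational polytope the description is
  unique up to the order of its rows, so exactly one \<open>r\<close> is related to \<open>P\<close>.
\<close>
definition has_codenominator :: "(real^'d) set \<Rightarrow> nat \<Rightarrow> bool" where
  "has_codenominator P r \<longleftrightarrow>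
     (\<exists>n A b. halfspace_description P n A b \<and> int r = Lcm {b i | i. i < n \<and> b i \<noteq> 0})"

definition ehr :: "(real^'d) set \<Rightarrow> real \<Rightarrow> nat" where
  "ehr P c = card {x \<in> dilate c P. \<forall>i. x $ i \<in> \<int>}"

text \<open>
  Series and polynomials in \<open>t\<^bsup>1/N\<^esup>\<close> are represented as formal power series and polynomials in
  the indeterminate \<open>s = t\<^bsup>1/N\<^esup>\<close>: the coefficient at index \<open>n\<close> belongs to \<open>t\<^bsup>n/N\<^esup>\<close>.
  Here \<open>N = 1\<close> for the integral, \<open>N = r\<close> for the rational and \<open>N = 2 r\<close> for the refined rational
  series, where \<open>r\<close> is the codenominator.
\<close>
definition Ehr_Z :: "(real^'d) set \<Rightarrow> int fps" where
  "Ehr_Z P = Abs_fps (\<lambda>n. if n = 0 then 1 else int (ehr P (real n)))"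

definition Ehr_Q :: "(real^'d) set \<Rightarrow> nat \<Rightarrow> int fps" where
  "Ehr_Q P r = Abs_fps (\<lambda>n. if n = 0 then 1 else int (ehr P (real n / real r)))"

definition Ehr_Q_ref :: "(real^'d) set \<Rightarrow> nat \<Rightarrow> int fps" where
  "Ehr_Q_ref P r = Abs_fps (\<lambda>n. if n = 0 then 1 else int (ehr P (real n / (2 * real r))))"

definition hstar_Z :: "(real^'d) set \<Rightarrow> int poly" where
  "hstar_Z P = (THE h. fps_of_poly h = Ehr_Z P * (1 - fps_X ^ denominator P) ^ (CARD('d) + 1))"

text \<open>
  In the indeterminate \<open>s\<close>, both \<open>t\<^bsup>m/r\<^esup>\<close> with \<open>s = t\<^bsup>1/r\<^esup>\<close> and \<open>t\<^bsup>m/(2r)\<^esup>\<close> with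
  \<open>s = t\<^bsup>1/(2r)\<^esup>\<close> become \<open>s\<^bsup>m\<^esup>\<close>.
\<close>
definition hstar_Q :: "(real^'d) set \<Rightarrow> nat \<Rightarrow> nat \<Rightarrow> int poly" where
  "hstar_Q P r m = (THE h. fps_of_poly h = Ehr_Q P r * (1 - fps_X ^ m) ^ (CARD('d) + 1))"

definition hstar_Q_ref :: "(real^'d) set \<Rightarrow> nat \<Rightarrow> nat \<Rightarrow> int poly" where
  "hstar_Q_ref P r m = (THE h. fps_of_poly h = Ehr_Q_ref P r * (1 - fps_X ^ m) ^ (CARD('d) + 1))"

text \<open>
  The terms with integer exponent of a polynomial in \<open>t\<^bsup>1/N\<^esup>\<close> (represented in \<open>s\<close>), returned as
  a polynomial in \<open>t\<close>: \<open>s\<^bsup>i\<^esup>\<close> is \<open>t\<^bsup>i/N\<^esup>\<close>.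
\<close>
definition Int_part :: "nat \<Rightarrow> int poly \<Rightarrow> int poly" where
  "Int_part N h = (\<Sum>i | i \<le> degree h \<and> N dvd i. monom (coeff h i) (i div N))"

end

theory Submission
  imports Defs
begin

text \<open>
  The integral Ehrhart series of \<open>P\<close> consists of the terms with integer exponent of the rational one,
  because \<open>ehr_Q(P; n r / r) = ehr_Z(P; n)\<close>. The operator \<open>Int\<close> commutes with multiplication by series in
  \<open>t\<close>, so if \<open>m / r\<close> is an integer it can be applied to the numerator of the rational series, whose
  denominator \<open>(1 - t\<^bsup>m/r\<^esup>)\<^bsup>d+1\<^esup>\<close> is such a series; this is \<open>hstar_Z_eq_Int_part_hstar_Q\<close>. The
  refined series is the rational series with \<open>2 r\<close> in place of \<open>r\<close>.

  What carries the weight is that the numerators exist as polynomials: if \<open>m Q\<close> is a lattice polytope, then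
  \<open>Ehr_Z Q * (1 - X\<^sup>m)\<^bsup>d+1\<^esup>\<close> is a polynomial (\<open>rational_order_Ehr_Z\<close>). Applied to \<open>Q = P\<close> and
  \<open>Q = (1/r) P\<close>, this covers all the series involved. The usual proof triangulates \<open>Q\<close>. The one below
  avoids triangulations in two steps. First, the integer points of the cone over \<open>Q\<close> are a finite union of
  orbits under adding lattice points that span \<open>m Q\<close>, placed at height \<open>m\<close>. Such orbits are Noetherian
  (\<open>orbit_ascending_chain\<close>), and cutting them into slices in the manner of Hilbert's theorem on graded modules
  (\<open>rational_order_orbit_diff\<close>) shows that some power of \<open>1 - X\<^sup>m\<close> turns the series into a polynomial;
  the exponent obtained this way depends on the number of spanning points and not on \<open>d\<close>. Second, the number of integer points in \<open>n Q\<close> is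
  \<open>O(n\<^sup>d)\<close>, and a series with coefficients of this size and a denominator \<open>(1 - X\<^sup>m)\<^sup>N\<close> already has the
  denominator \<open>(1 - X\<^sup>m)\<^bsup>d+1\<^esup>\<close> (\<open>rational_order_of_growth\<close>).
\<close>

section \<open>Power series with denominator a power of \<open>1 - X\<^sup>m\<close>\<close>

text \<open>
  The numerator may have any degree, so for \<open>m > 0\<close> this says that the coefficients are eventually given by
  polynomials of degree less than \<open>N\<close> on each residue class modulo \<open>m\<close>.
\<close>

definition rational_order :: "nat \<Rightarrow> nat \<Rightarrow> int fps \<Rightarrow> bool" where
  "rational_order m N f \<longleftrightarrow> (\<exists>p. f * (1 - fps_X ^ m) ^ N = fps_of_poly p)"

lemma ex_fps_of_poly_iff:
  fixes f :: "int fps"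
  shows "(\<exists>p. f = fps_of_poly p) \<longleftrightarrow> (\<exists>n0. \<forall>n\<ge>n0. f $ n = 0)"
proof
  assume "\<exists>p. f = fps_of_poly p"
  then obtain p where "f = fps_of_poly p" by blast
  then have "\<forall>n\<ge>Suc (degree p). f $ n = 0" by (auto simp: coeff_eq_0)
  then show "\<exists>n0. \<forall>n\<ge>n0. f $ n = 0" by blast
next
  assume "\<exists>n0. \<forall>n\<ge>n0. f $ n = 0"
  then obtain n0 where "\<forall>n\<ge>n0. f $ n = 0" by blast
  then have "f = fps_of_poly (truncate_fps n0 f)"
    by (auto simp: fps_eq_iff coeff_truncate_fps)
  then show "\<exists>p. f = fps_of_poly p" by blast
qed

lemma rational_order_add:
  assumes "rational_order m N f" "rational_order m N g"
  shows "rational_order m N (f + g)"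
  using assms unfolding rational_order_def
  by (metis distrib_right fps_of_poly_add)

lemma rational_order_Suc_iff:
  "rational_order m (Suc N) f \<longleftrightarrow> rational_order m N (f * (1 - fps_X ^ m))"
  by (simp add: rational_order_def mult.assoc)

lemma rational_order_Suc:
  assumes "rational_order m N f"
  shows "rational_order m (Suc N) f"
proof -
  obtain p where p: "f * (1 - fps_X ^ m) ^ N = fps_of_poly p"
    using assms unfolding rational_order_def by blast
  have "f * (1 - fps_X ^ m) ^ Suc N = fps_of_poly p * (1 - fps_X ^ m)"
    by (simp add: p[symmetric] mult_ac)
  also have "\<dots> = fps_of_poly (p * (1 - monom 1 m))"
    by (simp add: fps_of_poly_mult fps_of_poly_diff fps_of_poly_monom')
  finally show ?thesis unfolding rational_order_def by blast
qed

lemma rational_order_mono: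
  assumes "rational_order m M f" "M \<le> N"
  shows "rational_order m N f"
  using assms(2,1) by (induction rule: dec_induct) (auto intro: rational_order_Suc)

section \<open>Polynomial growth bounds the order of the pole\<close>

text \<open>
  Summation turns growth at least \<open>q\<^sup>k\<close> into growth at least \<open>q\<^bsup>k+1\<^esup>\<close>: the differences of
  \<open>q\<^bsup>k+1\<^esup>\<close> are at most \<open>(k + 1) (q + 1)\<^sup>k\<close>, so \<open>b q - d q\<^bsup>k+1\<^esup>\<close> is eventually nondecreasing
  for \<open>d = e / (k + 1)\<close>; halving \<open>d\<close> absorbs the constant of summation.
\<close>

lemma growth_of_sum:
  fixes b :: "nat \<Rightarrow> real"
  assumes "e > 0" and "\<forall>\<^sub>F q in sequentially. e * real (Suc q) ^ k \<le> b (Suc q) - b q"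
  shows "\<exists>e'>0. \<forall>\<^sub>F q in sequentially. e' * real q ^ Suc k \<le> b q"
proof -
  define d where "d = e / real (Suc k)"
  have d: "d > 0" "d * real (Suc k) = e" using assms(1) by (auto simp: d_def)
  obtain q0 where q0: "\<And>q. q \<ge> q0 \<Longrightarrow> e * real (Suc q) ^ k \<le> b (Suc q) - b q"
    using assms(2) unfolding eventually_sequentially by blast
  have power_step: "real (Suc q) ^ Suc k - real q ^ Suc k \<le> real (Suc k) * real (Suc q) ^ k" for q
  proof -
    have "real (Suc q) ^ Suc k - real q ^ Suc k
        = (real (Suc q) - real q) * (\<Sum>i<Suc k. real (Suc q) ^ i * real q ^ (k - i))"
      by (rule power_diff_sumr2[of "real (Suc q)" "Suc k" "real q", simplified diff_Suc_Suc, THEN trans])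
         (auto simp: mult_ac diff_Suc_eq_diff_pred intro!: sum.cong)
    also have "\<dots> = (\<Sum>i<Suc k. real (Suc q) ^ i * real q ^ (k - i))" by simp
    also have "\<dots> \<le> (\<Sum>i<Suc k. real (Suc q) ^ k)"
    proof (rule sum_mono)
      fix i assume "i \<in> {..<Suc k}"
      then have "real (Suc q) ^ k = real (Suc q) ^ i * real (Suc q) ^ (k - i)"
        by (simp flip: power_add)
      moreover have "real q ^ (k - i) \<le> real (Suc q) ^ (k - i)" by (intro power_mono) auto
      ultimately show "real (Suc q) ^ i * real q ^ (k - i) \<le> real (Suc q) ^ k"
        by (simp add: mult_left_mono)
    qed
    finally show ?thesis by simp
  qed
  define c where "c = b q0 - d * real q0 ^ Suc k"
  have low: "c \<le> b q - d * real q ^ Suc k" if "q \<ge> q0" for q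
    using that
  proof (induction rule: dec_induct)
    case base show ?case by (simp add: c_def)
  next
    case (step n)
    have "d * (real (Suc n) ^ Suc k - real n ^ Suc k) \<le> d * (real (Suc k) * real (Suc n) ^ k)"
      using \<open>d > 0\<close> power_step
      by (intro mult_left_mono) auto
    also have "\<dots> = e * real (Suc n) ^ k" using d(2) by (metis mult.assoc)
    also have "\<dots> \<le> b (Suc n) - b n" using q0 step by auto
    finally show ?case using step.IH by (simp add: right_diff_distrib)
  qed
  have "\<forall>\<^sub>F q in sequentially. (d / 2) * real q ^ Suc k \<le> b q"
  proof -
    obtain q1 where q1: "real q1 \<ge> 2 * \<bar>c\<bar> / d" using real_arch_simple by blast
    have "(d / 2) * real q ^ Suc k \<le> b q" if "q \<ge> max (max q0 q1) 1" for q
    proof -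
      have "real q ^ 1 \<le> real q ^ Suc k" using that by (intro power_increasing) auto
      moreover have "real q \<ge> 2 * \<bar>c\<bar> / d" using q1 that by linarith
      ultimately have "real q ^ Suc k \<ge> 2 * \<bar>c\<bar> / d" by simp
      then have "d * real q ^ Suc k \<ge> 2 * \<bar>c\<bar>" using d(1) by (simp add: field_simps)
      then show ?thesis using low[of q] that by (simp add: field_simps)
    qed
    then show ?thesis unfolding eventually_sequentially by blast
  qed
  then show ?thesis using d(1) by (intro exI[of _ "d/2"]) auto
qed

lemma not_power_dominates:
  fixes e C :: real
  assumes "e > 0" "d < M" "\<forall>\<^sub>F q in sequentially. e * real q ^ M \<le> C * real (Suc q) ^ d"
  shows False
proof -
  obtain q0 where q0: "\<And>q. q \<ge> q0 \<Longrightarrow> e * real q ^ M \<le> C * real (Suc q) ^ d"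
    using assms(3) unfolding eventually_sequentially by blast
  obtain q1 where q1: "real q1 > \<bar>C\<bar> * 2 ^ d / e" using reals_Archimedean2 by blast
  define q where "q = max (max q0 q1) 1"
  have q: "q \<ge> q0" "q \<ge> q1" "q \<ge> 1" by (auto simp: q_def)
  have "e * real q ^ d * real q = e * real q ^ Suc d" by simp
  also have "\<dots> \<le> e * real q ^ M"
    using q assms by (intro mult_left_mono power_increasing) auto
  also have "\<dots> \<le> C * real (Suc q) ^ d" using q0 q by blast
  also have "\<dots> \<le> \<bar>C\<bar> * (2 * real q) ^ d"
    using q by (intro mult_mono power_mono) auto
  also have "\<dots> = (\<bar>C\<bar> * 2 ^ d) * real q ^ d" by (simp add: power_mult_distrib)
  finally have "e * real q * real q ^ d \<le> \<bar>C\<bar> * 2 ^ d * real q ^ d" by (simp add: mult_ac)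
  moreover have "real q ^ d > 0" using q by simp
  ultimately have "e * real q \<le> \<bar>C\<bar> * 2 ^ d" by (meson mult_le_cancel_right_pos)
  moreover have "real q > \<bar>C\<bar> * 2 ^ d / e" using q1 q by linarith
  ultimately show False using assms(1) by (simp add: field_simps)
qed

text \<open>
  If \<open>f (1 - X\<^sup>m)\<^bsup>M+1\<^esup>\<close> is a polynomial, then the coefficients of \<open>g = f (1 - X\<^sup>m)\<^sup>M\<close> are eventually
  periodic with period \<open>m\<close>. A nonzero value \<open>c\<close> in the period is then the constant \<open>M\<close>-th difference
  of the coefficients of \<open>f\<close> along a residue class, and summing \<open>M\<close> times makes these coefficients
  grow like \<open>q\<^sup>M\<close>, which is more than the bound allows. So the period is zero and \<open>g\<close> is a polynomial.
\<close>

lemma rational_order_lower: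
  fixes f :: "int fps"
  assumes m: "m > 0" and bound: "\<And>n. \<bar>real_of_int (f $ n)\<bar> \<le> C * real (Suc n) ^ d"
    and "d < M" and rat: "rational_order m (Suc M) f"
  shows "rational_order m M f"
proof (rule ccontr)
  assume non: "\<not> rational_order m M f"
  define g where "g k = f * (1 - fps_X ^ m) ^ k" for k
  have g_Suc: "g (Suc k) $ (n + m) = g k $ (n + m) - g k $ n" for k n
  proof -
    have "g (Suc k) = g k - fps_X ^ m * g k" by (simp add: g_def algebra_simps)
    then show ?thesis by (simp add: fps_X_power_mult_nth)
  qed
  obtain n0 where n0: "\<And>n. n \<ge> n0 \<Longrightarrow> g (Suc M) $ n = 0"
    using rat ex_fps_of_poly_iff[of "g (Suc M)"] unfolding rational_order_def g_def by blast
  obtain n1 where n1: "n1 \<ge> n0" "g M $ n1 \<noteq> 0"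
    using non ex_fps_of_poly_iff[of "g M"] unfolding rational_order_def g_def by blast
  define c where "c = real_of_int (g M $ n1)"
  \<comment> \<open>The factor \<open>sgn c\<close> makes the \<open>M\<close>-th difference positive, so lower bounds suffice.\<close>
  define a where "a k q = sgn c * real_of_int (g k $ (n1 + m * q))" for k q
  have c: "c \<noteq> 0" using n1 by (simp add: c_def)
  have a_Suc: "a (Suc k) (Suc q) = a k (Suc q) - a k q" for k q
  proof -
    have "n1 + m * Suc q = (n1 + m * q) + m" by simp
    then show ?thesis using g_Suc[of k "n1 + m * q"]
      by (simp only: a_def of_int_diff right_diff_distrib)
  qed
  have top: "a M q = \<bar>c\<bar>" for q
  proof (induction q)
    case 0 show ?case by (simp add: a_def c_def abs_sgn)
  next
    case (Suc q)
    have "g (Suc M) $ (n1 + m * Suc q) = 0" using n1 by (intro n0) auto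
    then have "a (Suc M) (Suc q) = 0" by (simp add: a_def)
    then show ?case using a_Suc[of M q] Suc by simp
  qed
  have growth: "k \<le> M \<Longrightarrow> \<exists>e>0. \<forall>\<^sub>F q in sequentially. e * real q ^ k \<le> a (M - k) q" for k
  proof (induction k)
    case 0
    show ?case using c top by (intro exI[of _ "\<bar>c\<bar>"]) auto
  next
    case (Suc k)
    then obtain e where e: "e > 0" "\<forall>\<^sub>F q in sequentially. e * real q ^ k \<le> a (M - k) q" by auto
    have "M - k = Suc (M - Suc k)" using Suc.prems by simp
    then have "\<forall>\<^sub>F q in sequentially. e * real (Suc q) ^ k \<le> a (M - Suc k) (Suc q) - a (M - Suc k) q"
      using eventually_sequentially_Suc[THEN iffD2, OF e(2)] a_Suc by simp
    then show ?case using growth_of_sum e(1) by blast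
  qed
  obtain e where e: "e > 0" "\<forall>\<^sub>F q in sequentially. e * real q ^ M \<le> a 0 q"
    using growth[of M] by auto
  have C: "C \<ge> 0" using bound[of 0] by auto
  have upper: "a 0 q \<le> (C * real (n1 + m + 1) ^ d) * real (Suc q) ^ d" for q
  proof -
    have "a 0 q \<le> \<bar>real_of_int (f $ (n1 + m * q))\<bar>"
      by (auto simp: a_def g_def sgn_if)
    also have "\<dots> \<le> C * real (Suc (n1 + m * q)) ^ d" by (rule bound)
    also have "\<dots> \<le> C * (real ((n1 + m + 1) * Suc q)) ^ d"
    proof -
      have "Suc (n1 + m * q) \<le> (n1 + m + 1) * Suc q" by (simp add: algebra_simps)
      then have "real (Suc (n1 + m * q)) \<le> real ((n1 + m + 1) * Suc q)" by (rule of_nat_mono)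
      then show ?thesis using C by (intro mult_left_mono power_mono) auto
    qed
    also have "\<dots> = (C * real (n1 + m + 1) ^ d) * real (Suc q) ^ d"
      by (simp only: of_nat_mult power_mult_distrib mult.assoc)
    finally show ?thesis .
  qed
  have "\<forall>\<^sub>F q in sequentially. e * real q ^ M \<le> (C * real (n1 + m + 1) ^ d) * real (Suc q) ^ d"
    using e(2) by eventually_elim (use upper order_trans in blast)
  then show False using not_power_dominates e(1) \<open>d < M\<close> by blast
qed

lemma rational_order_of_growth:
  fixes f :: "int fps"
  assumes m: "m > 0" and bound: "\<And>n. \<bar>real_of_int (f $ n)\<bar> \<le> C * real (Suc n) ^ d"
    and rat: "rational_order m N f"
  shows "rational_order m (d + 1) f"
proof (cases "N \<le> d + 1")
  case True
  then show ?thesis using rat rational_order_mono by blast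
next
  case False
  then have "d + 1 \<le> N" by simp
  then show ?thesis using rat
  proof (induction rule: inc_induct)
    case (step n)
    have "rational_order m n f" if "rational_order m (Suc n) f"
      using rational_order_lower[OF m bound _ that] step.hyps by simp
    then show ?case using step by blast
  qed
qed

section \<open>Orbits under finitely many translations\<close>

text \<open>
  The points \<open>b + k\<^sub>1 v\<^sub>1 + \<dots> + k\<^sub>n v\<^sub>n\<close> with natural \<open>k\<^sub>i\<close>. Splitting off the translations one at a time
  is what the inductions below run on.
\<close>

fun orbit :: "'a::real_vector list \<Rightarrow> 'a \<Rightarrow> 'a set" where
  "orbit [] b = {b}"
| "orbit (v # vs) b = (\<Union>k::nat. orbit vs (b + real k *\<^sub>R v))"

definition translation_closed :: "'a::real_vector list \<Rightarrow> 'a set \<Rightarrow> bool" where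
  "translation_closed vs T \<longleftrightarrow> (\<forall>x\<in>T. \<forall>v\<in>set vs. x + v \<in> T)"

lemma orbit_translate: "orbit vs (c + b) = (+) c ` orbit vs b"
  by (induction vs arbitrary: b) (auto simp: add.assoc image_UN)

lemma mem_orbit_translate: "x + c \<in> orbit vs (b + c) \<longleftrightarrow> x \<in> orbit vs b"
  using orbit_translate[of vs c b] by (force simp: add.commute)

lemma base_in_orbit: "b \<in> orbit vs b"
proof (induction vs arbitrary: b)
  case (Cons v vs)
  have "b \<in> orbit vs (b + real 0 *\<^sub>R v)" using Cons[of b] by simp
  then show ?case unfolding orbit.simps by blast
qed simp

lemma orbit_closed: "translation_closed vs (orbit vs b)"
proof (induction vs arbitrary: b)
  case Nil then show ?case by (simp add: translation_closed_def)
next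
  case (Cons v vs)
  have "x + w \<in> orbit (v # vs) b" if x: "x \<in> orbit (v # vs) b" and w: "w \<in> set (v # vs)" for x w
  proof -
    obtain k :: nat where k: "x \<in> orbit vs (b + real k *\<^sub>R v)" using x by auto
    show ?thesis
    proof (cases "w = v")
      case True
      have "x + v \<in> orbit vs ((b + real k *\<^sub>R v) + v)" using k by (simp only: mem_orbit_translate)
      also have "(b + real k *\<^sub>R v) + v = b + real (Suc k) *\<^sub>R v" by (simp add: algebra_simps)
      finally show ?thesis using True unfolding orbit.simps by blast
    next
      case False
      then have "x + w \<in> orbit vs (b + real k *\<^sub>R v)"
        using Cons w k by (auto simp: translation_closed_def)
      then show ?thesis by auto
    qed
  qed
  then show ?case by (auto simp only: translation_closed_def)
qed

lemma orbit_subset: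
  assumes "translation_closed vs S" "b \<in> S"
  shows "orbit vs b \<subseteq> S"
  using assms
proof (induction vs arbitrary: b)
  case (Cons v vs)
  have "b + real k *\<^sub>R v \<in> S" for k
  proof (induction k)
    case (Suc k)
    then have "(b + real k *\<^sub>R v) + v \<in> S" using Cons.prems by (auto simp: translation_closed_def)
    then show ?case by (simp add: algebra_simps)
  qed (use Cons.prems in simp)
  then show ?case using Cons by (auto simp: translation_closed_def)
qed simp

lemma translation_closed_shift:
  assumes "translation_closed vs T"
  shows "translation_closed vs {x. x + c \<in> T}"
  using assms by (fastforce simp: translation_closed_def algebra_simps)

text \<open>
  Orbits are Noetherian. This is Dickson's lemma, proved like Hilbert's basis theorem: an orbit of
  \<open>v # vs\<close> is made of slices, translates by \<open>i v\<close> of one orbit of \<open>vs\<close>, and the trace \<open>U i j\<close> of \<open>T j\<close> on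
  the \<open>i\<close>-th slice, moved back to the first slice, increases in both indices. The diagonal
  \<open>U j j\<close> is stationary from some \<open>J\<close> on, which settles all slices \<open>i \<ge> J\<close>; each of the finitely many
  slices before \<open>J\<close> is stationary by induction.
\<close>

lemma orbit_ascending_chain:
  assumes "\<And>j. translation_closed vs (T j)" "incseq T"
  shows "\<exists>J. \<forall>j\<ge>J. orbit vs b \<inter> T j = orbit vs b \<inter> T J"
  using assms
proof (induction vs arbitrary: b T)
  case Nil
  show ?case
  proof (cases "\<exists>j. b \<in> T j")
    case True
    then obtain J where "b \<in> T J" by blast
    then have "\<forall>j\<ge>J. b \<in> T j" using Nil(2) by (auto simp: incseq_def)
    then show ?thesis by (intro exI[of _ J]) auto
  qed auto
next
  case (Cons v vs)
  define U where "U i j = {x. x + real i *\<^sub>R v \<in> T j}" for i j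
  have closed: "translation_closed vs (U i j)" for i j
    unfolding U_def by (intro translation_closed_shift) (use Cons.prems(1)[of j] in \<open>simp add: translation_closed_def\<close>)
  have U_j: "U i j \<subseteq> U i j'" if "j \<le> j'" for i j j'
    using Cons.prems(2) that by (auto simp: U_def incseq_def)
  have U_Suc: "U i j \<subseteq> U (Suc i) j" for i j
  proof
    fix x assume "x \<in> U i j"
    then have "(x + real i *\<^sub>R v) + v \<in> T j"
      using Cons.prems(1)[of j] by (simp add: U_def translation_closed_def)
    then show "x \<in> U (Suc i) j" by (simp add: U_def algebra_simps)
  qed
  have U_i: "U i j \<subseteq> U i' j" if "i \<le> i'" for i i' j
    using lift_Suc_mono_le[of "\<lambda>i. U i j", OF U_Suc that] .
  have "incseq (\<lambda>j. U j j)"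
    unfolding incseq_def using U_i U_j by (meson order_trans)
  then obtain J where J: "\<And>j. j \<ge> J \<Longrightarrow> orbit vs b \<inter> U j j = orbit vs b \<inter> U J J"
    using Cons.IH[of "\<lambda>j. U j j" b] closed by blast
  have "\<exists>K. \<forall>j\<ge>K. orbit vs b \<inter> U i j = orbit vs b \<inter> U i K" for i
    using Cons.IH[of "\<lambda>j. U i j" b] closed U_j by (auto simp: incseq_def)
  then obtain K where K: "\<And>i j. j \<ge> K i \<Longrightarrow> orbit vs b \<inter> U i j = orbit vs b \<inter> U i (K i)"
    by metis
  define L where "L = Max (insert J (K ` {..<J}))"
  have L: "J \<le> L" "\<And>i. i < J \<Longrightarrow> K i \<le> L" by (auto simp: L_def)
  have stable: "orbit vs b \<inter> U i j \<subseteq> U i L" if "j \<ge> L" for i j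
  proof (cases "i < J")
    case True
    then show ?thesis using K[of i j] K[of i L] L(2)[of i] that by auto
  next
    case False
    have "U i j \<subseteq> U (max i j) (max i j)" using U_i U_j by (meson max.cobounded1 max.cobounded2 order_trans)
    moreover have "orbit vs b \<inter> U (max i j) (max i j) = orbit vs b \<inter> U J J"
      using False by (intro J) auto
    moreover have "U J J \<subseteq> U i L" using U_i[of J i J] U_j[of J L i] False L(1) by auto
    ultimately show ?thesis by blast
  qed
  have "orbit (v # vs) b \<inter> T j = orbit (v # vs) b \<inter> T L" if "j \<ge> L" for j
  proof
    show "orbit (v # vs) b \<inter> T L \<subseteq> orbit (v # vs) b \<inter> T j"
      using Cons.prems(2) that by (auto simp: incseq_def)
    show "orbit (v # vs) b \<inter> T j \<subseteq> orbit (v # vs) b \<inter> T L"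
    proof
      fix x assume x: "x \<in> orbit (v # vs) b \<inter> T j"
      then obtain i :: nat where i: "x \<in> orbit vs (b + real i *\<^sub>R v)" by auto
      define y where "y = x - real i *\<^sub>R v"
      have xy: "x = y + real i *\<^sub>R v" by (simp add: y_def)
      have "y \<in> orbit vs b" using i unfolding xy by (simp only: mem_orbit_translate)
      moreover have "y \<in> U i j" using x xy by (simp add: U_def)
      ultimately have "y \<in> U i L" using stable[OF that] by blast
      then show "x \<in> orbit (v # vs) b \<inter> T L" using x xy by (simp add: U_def)
    qed
  qed
  then show ?case by blast
qed

section \<open>Counting series of finite unions of orbits\<close>

definition counting_series :: "('a \<Rightarrow> real) \<Rightarrow> 'a set \<Rightarrow> int fps" where
  "counting_series ht A = Abs_fps (\<lambda>n. int (card {x \<in> A. ht x = real n}))"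

text \<open>
  A set with finite layers on which translations of degree \<open>m\<close> act. The series of every subset is
  then meaningful, and a translation by a generator multiplies it by \<open>X\<^sup>m\<close>.
\<close>

locale graded_translations =
  fixes S :: "'a::real_vector set" and G :: "'a set" and ht :: "'a \<Rightarrow> real" and m :: nat
  assumes ht_add: "\<And>x y. ht (x + y) = ht x + ht y"
    and ht_generator: "\<And>v. v \<in> G \<Longrightarrow> ht v = real m"
    and ht_nonneg: "\<And>x. x \<in> S \<Longrightarrow> 0 \<le> ht x"
    and closed: "\<And>x v. x \<in> S \<Longrightarrow> v \<in> G \<Longrightarrow> x + v \<in> S"
    and finite_layer: "\<And>n::nat. finite {x \<in> S. ht x = real n}"
begin

lemma counting_series_disjoint_union:
  assumes "A \<subseteq> S" "B \<subseteq> S" "A \<inter> B = {}"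
  shows "counting_series ht (A \<union> B) = counting_series ht A + counting_series ht B"
proof -
  have "card {x \<in> A \<union> B. ht x = real n} = card {x \<in> A. ht x = real n} + card {x \<in> B. ht x = real n}" for n
  proof -
    have "{x \<in> A \<union> B. ht x = real n} = {x \<in> A. ht x = real n} \<union> {x \<in> B. ht x = real n}" by auto
    moreover have "finite {x \<in> A. ht x = real n}" "finite {x \<in> B. ht x = real n}"
      using assms by (auto intro: finite_subset[OF _ finite_layer[of n]])
    ultimately show ?thesis using assms(3) by (simp add: card_Un_disjoint disjoint_iff)
  qed
  then show ?thesis by (simp add: counting_series_def fps_eq_iff)
qed

lemma counting_series_translate:
  assumes "A \<subseteq> S" "v \<in> G"
  shows "counting_series ht ((+) v ` A) = fps_X ^ m * counting_series ht A"
proof -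
  have "card {x \<in> (+) v ` A. ht x = real n} = (if n < m then 0 else card {x \<in> A. ht x = real (n - m)})" for n
  proof -
    have eq: "{x \<in> (+) v ` A. ht x = real n} = (+) v ` {x \<in> A. ht x = real n - real m}"
      using assms(2) by (auto simp: ht_add ht_generator)
    show ?thesis
    proof (cases "n < m")
      case True
      have none: "{x \<in> A. ht x = real n - real m} = {}" using True assms(1) ht_nonneg by fastforce
      show ?thesis unfolding eq none using True by simp
    next
      case False
      then show ?thesis using eq by (simp add: of_nat_diff card_image)
    qed
  qed
  then show ?thesis by (simp add: counting_series_def fps_eq_iff fps_X_power_mult_nth)
qed

text \<open>
  Relative version of Hilbert's theorem on the series of a finitely generated graded module, without
  any algebra. The slices \<open>Y k\<close> of an orbit of \<open>v # vs\<close> may overlap each other; letting \<open>T' k\<close> collect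
  \<open>T\<close> and all earlier slices makes the differences \<open>A k = Y k - T' k\<close> disjoint and keeps them of the
  form covered by the induction hypothesis. This is the reason for the subtracted closed set \<open>T\<close> in
  the statement. Moved back by \<open>k v\<close>, the sets \<open>T' k\<close> form an ascending chain, so from some
  \<open>J\<close> on \<open>A (k + 1)\<close> is the translate of \<open>A k\<close> by \<open>v\<close>. The tail \<open>E J\<close> therefore satisfies
  \<open>E J = A J + X\<^sup>m E J\<close> for the series, which costs exactly one factor \<open>1 - X\<^sup>m\<close>, and only finitely many
  \<open>A k\<close> remain to be added.
\<close>

lemma rational_order_orbit_diff:
  assumes "set vs \<subseteq> G" "b \<in> S" "translation_closed vs T"
  shows "rational_order m (length vs) (counting_series ht (orbit vs b - T))"
  using assms
proof (induction vs arbitrary: b T)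
  case Nil
  obtain n0 :: nat where n0: "ht b < real n0" using reals_Archimedean2 by blast
  have "counting_series ht (orbit [] b - T) $ n = 0" if "n \<ge> n0" for n
  proof -
    have "{x \<in> orbit [] b - T. ht x = real n} = {}" using n0 that by auto
    then show ?thesis unfolding counting_series_def by simp
  qed
  then show ?case
    using ex_fps_of_poly_iff[of "counting_series ht (orbit [] b - T)"]
    by (auto simp: rational_order_def)
next
  case (Cons v vs)
  have v: "v \<in> G" and vs: "set vs \<subseteq> G" using Cons.prems by auto
  have closed_S: "translation_closed vs S" "translation_closed [v] S"
    using closed v vs by (auto simp: translation_closed_def)
  define Y where "Y k = orbit vs (b + real k *\<^sub>R v)" for k :: nat
  define T' where "T' k = T \<union> (\<Union>i<k. Y i)" for k :: nat
  define A where "A k = Y k - T' k" for k :: nat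
  define E where "E k = (\<Union>i\<in>{k..}. Y i) - T' k" for k :: nat
  define U where "U k = {x. x + real k *\<^sub>R v \<in> T' k}" for k :: nat
  have base: "b + real k *\<^sub>R v \<in> S" for k
    using orbit_subset[OF closed_S(2) Cons.prems(2)] base_in_orbit[of "b + real k *\<^sub>R v" "[]"] by auto
  have Y_S: "Y k \<subseteq> S" for k unfolding Y_def by (rule orbit_subset[OF closed_S(1) base])
  have Y_shift: "x + real k *\<^sub>R v \<in> Y (i + k) \<longleftrightarrow> x \<in> Y i" for x i k
    using mem_orbit_translate[of x "real k *\<^sub>R v" vs "b + real i *\<^sub>R v"]
    by (simp add: Y_def scaleR_add_left add.assoc)
  have T'_closed: "translation_closed vs (T' k)" for k
    using Cons.prems(3) orbit_closed[of vs] by (fastforce simp: T'_def Y_def translation_closed_def)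
  have U_inc: "incseq U"
  proof (rule incseq_SucI, rule subsetI)
    fix k x assume "x \<in> U k"
    then consider "x + real k *\<^sub>R v \<in> T" | i where "i < k" "x + real k *\<^sub>R v \<in> Y i"
      by (auto simp: U_def T'_def)
    then have "(x + real k *\<^sub>R v) + v \<in> T' (Suc k)"
    proof cases
      case 1
      then show ?thesis using Cons.prems(3) by (simp add: T'_def translation_closed_def)
    next
      case (2 i)
      then have "(x + real k *\<^sub>R v) + v \<in> Y (Suc i)" using Y_shift[of _ 1 i] by simp
      then show ?thesis using 2 by (auto simp: T'_def)
    qed
    then show "x \<in> U (Suc k)" by (simp add: U_def algebra_simps)
  qed
  obtain J where J: "\<And>k. k \<ge> J \<Longrightarrow> Y 0 \<inter> U k = Y 0 \<inter> U J"
    using orbit_ascending_chain[of vs U, OF _ U_inc] translation_closed_shift[OF T'_closed]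
    unfolding Y_def U_def by blast
  have A_translate: "A k = (+) (real k *\<^sub>R v) ` (Y 0 - U k)" for k
  proof -
    have "x \<in> A k \<longleftrightarrow> x - real k *\<^sub>R v \<in> Y 0 - U k" for x
      using Y_shift[of "x - real k *\<^sub>R v" k 0] by (simp add: A_def U_def)
    moreover have "x \<in> (+) c ` B \<longleftrightarrow> x - c \<in> B" for x c :: 'a and B
      by (auto simp: image_iff intro: bexI[of _ "x - c"])
    ultimately show ?thesis by blast
  qed
  have A_Suc: "A (Suc k) = (+) v ` A k" if "k \<ge> J" for k
  proof -
    have "Y 0 - U (Suc k) = Y 0 - U k" using J[of k] J[of "Suc k"] that by auto
    then show ?thesis by (simp add: A_translate image_image algebra_simps)
  qed
  have E_union: "E k = (\<Union>i\<in>{k..}. A i)" for k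
  proof
    show "E k \<subseteq> (\<Union>i\<in>{k..}. A i)"
    proof
      fix x assume x: "x \<in> E k"
      define i where "i = (LEAST i. i \<ge> k \<and> x \<in> Y i)"
      have i: "i \<ge> k" "x \<in> Y i"
        using x LeastI_ex[of "\<lambda>i. i \<ge> k \<and> x \<in> Y i"] by (auto simp: E_def i_def)
      have "x \<notin> Y j" if "j < i" for j
      proof (cases "j < k")
        case True then show ?thesis using x by (auto simp: E_def T'_def)
      next
        case False then show ?thesis using not_less_Least[of j "\<lambda>i. i \<ge> k \<and> x \<in> Y i"] that by (auto simp: i_def)
      qed
      then have "x \<in> A i" using i x by (auto simp: A_def T'_def E_def)
      then show "x \<in> (\<Union>i\<in>{k..}. A i)" using i by auto
    qed
    have "A i \<subseteq> Y i - T' k" if "i \<ge> k" for i using that by (force simp: A_def T'_def)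
    then show "(\<Union>i\<in>{k..}. A i) \<subseteq> E k" by (fastforce simp: E_def)
  qed
  have E_split: "E k = A k \<union> E (Suc k)" for k
  proof -
    have "{k..} = insert k {Suc k..}" by auto
    then show ?thesis unfolding E_union by simp
  qed
  have E_disj: "A k \<inter> E (Suc k) = {}" for k
    by (auto simp: A_def E_def T'_def)
  have AE_S: "A k \<subseteq> S" "E k \<subseteq> S" for k using Y_S by (auto simp: A_def E_def)
  have count_split: "counting_series ht (E k) = counting_series ht (A k) + counting_series ht (E (Suc k))" for k
    using counting_series_disjoint_union[OF AE_S E_disj] E_split by metis
  have count_A: "rational_order m (length vs) (counting_series ht (A k))" for k
    unfolding A_def Y_def by (rule Cons.IH[OF vs base T'_closed])
  have "E (Suc J) = (+) v ` E J"
  proof -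
    have "i \<in> {Suc J..} \<longleftrightarrow> i \<in> Suc ` {J..}" for i by (cases i) auto
    then have "{Suc J..} = Suc ` {J..}" by blast
    then have "E (Suc J) = (\<Union>i\<in>{J..}. A (Suc i))" unfolding E_union by (simp add: image_image)
    also have "\<dots> = (\<Union>i\<in>{J..}. (+) v ` A i)" using A_Suc by auto
    also have "\<dots> = (+) v ` E J" unfolding E_union by blast
    finally show ?thesis .
  qed
  then have "counting_series ht (E J) = counting_series ht (A J) + fps_X ^ m * counting_series ht (E J)"
    using count_split[of J] counting_series_translate[OF AE_S(2) v] by simp
  then have "counting_series ht (E J) * (1 - fps_X ^ m) = counting_series ht (A J)"
    by (simp add: algebra_simps)
  then have "rational_order m (Suc (length vs)) (counting_series ht (E J))"
    using count_A by (simp add: rational_order_Suc_iff)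
  moreover have "rational_order m (Suc (length vs)) (counting_series ht (E k))"
    if "rational_order m (Suc (length vs)) (counting_series ht (E (Suc k)))" for k
    unfolding count_split[of k] using that count_A rational_order_add rational_order_Suc by blast
  ultimately have "rational_order m (Suc (length vs)) (counting_series ht (E 0))"
    using inc_induct[of 0 J "\<lambda>k. rational_order m (Suc (length vs)) (counting_series ht (E k))"] by blast
  moreover have "E 0 = orbit (v # vs) b - T" by (simp add: E_def T'_def Y_def)
  ultimately show ?case by simp
qed

lemma rational_order_finite_union:
  assumes "set vs \<subseteq> G" "finite B" "B \<subseteq> S"
  shows "rational_order m (length vs) (counting_series ht (\<Union>b\<in>B. orbit vs b))"
  using assms(2,3)
proof (induction rule: finite_induct)
  case empty
  have "counting_series ht {} = 0" by (simp add: counting_series_def fps_eq_iff)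
  then have "counting_series ht (\<Union>b\<in>{}. orbit vs b) * (1 - fps_X ^ m) ^ length vs = fps_of_poly 0"
    by simp
  then show ?case unfolding rational_order_def by blast
next
  case (insert b B)
  let ?T = "\<Union>b\<in>B. orbit vs b"
  have closed_S: "translation_closed vs S" using closed assms(1) by (auto simp: translation_closed_def)
  have sub: "?T \<subseteq> S" "orbit vs b - ?T \<subseteq> S"
    using insert.prems orbit_subset[OF closed_S] by blast+
  have "translation_closed vs ?T"
    using orbit_closed[of vs] by (fastforce simp: translation_closed_def)
  then have "rational_order m (length vs) (counting_series ht (orbit vs b - ?T))"
    using insert.prems by (intro rational_order_orbit_diff assms(1)) auto
  moreover have "rational_order m (length vs) (counting_series ht ?T)"
    using insert.prems by (intro insert.IH) auto
  moreover have "counting_series ht (\<Union>b\<in>insert b B. orbit vs b)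
      = counting_series ht ?T + counting_series ht (orbit vs b - ?T)"
  proof -
    have "(\<Union>b\<in>insert b B. orbit vs b) = ?T \<union> (orbit vs b - ?T)" by auto
    then show ?thesis using counting_series_disjoint_union[OF sub] by simp
  qed
  ultimately show ?case using rational_order_add by simp
qed

end

section \<open>Ehrhart series of rational polytopes\<close>

lemma dilate_dilate: "dilate a (dilate b P) = dilate (a * b) P"
  by (simp add: dilate_def image_image)

text \<open>
  In this form the cone over the polytope is visible: enlarging one weight \<open>u v\<close> by \<open>1\<close> adds the point
  \<open>v\<close> and raises the dilation factor by \<open>1\<close>.
\<close>

lemma dilate_convex_hull_finite:
  fixes V :: "(real^'d) set"
  assumes "finite V" "V \<noteq> {}" "s \<ge> 0"
  shows "x \<in> dilate s (convex hull V) \<longleftrightarrow>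
    (\<exists>u. (\<forall>v\<in>V. 0 \<le> u v) \<and> sum u V = s \<and> (\<Sum>v\<in>V. u v *\<^sub>R v) = x)"
proof
  assume "x \<in> dilate s (convex hull V)"
  then obtain u where u: "\<forall>v\<in>V. 0 \<le> u v" "sum u V = 1" "s *\<^sub>R (\<Sum>v\<in>V. u v *\<^sub>R v) = x"
    unfolding dilate_def convex_hull_finite[OF assms(1)] by auto
  then show "\<exists>u. (\<forall>v\<in>V. 0 \<le> u v) \<and> sum u V = s \<and> (\<Sum>v\<in>V. u v *\<^sub>R v) = x"
    using assms(3) by (intro exI[of _ "\<lambda>v. s * u v"]) (auto simp: scaleR_sum_right simp flip: sum_distrib_left)
next
  assume "\<exists>u. (\<forall>v\<in>V. 0 \<le> u v) \<and> sum u V = s \<and> (\<Sum>v\<in>V. u v *\<^sub>R v) = x"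
  then obtain u where u: "\<forall>v\<in>V. 0 \<le> u v" "sum u V = s" "(\<Sum>v\<in>V. u v *\<^sub>R v) = x" by blast
  show "x \<in> dilate s (convex hull V)"
  proof (cases "s = 0")
    case True
    then have "\<forall>v\<in>V. u v = 0" using u(1,2) assms(1) by (simp add: sum_nonneg_eq_0_iff)
    then have "x = 0" using u(3) by (metis (mono_tags, lifting) scaleR_zero_left sum.neutral)
    then show ?thesis using True assms(2) by (auto simp: dilate_def image_iff)
  next
    case False
    have "(\<Sum>v\<in>V. (u v / s) *\<^sub>R v) \<in> convex hull V"
      unfolding convex_hull_finite[OF assms(1)] using u(1,2) False assms(3)
      by (auto intro!: exI[of _ "\<lambda>v. u v / s"] simp flip: sum_divide_distrib)
    moreover have "x = s *\<^sub>R (\<Sum>v\<in>V. (u v / s) *\<^sub>R v)"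
      using u(3) False by (simp add: scaleR_sum_right)
    ultimately show ?thesis unfolding dilate_def by blast
  qed
qed

lemma card_integer_points_in_box:
  fixes L :: nat
  defines "Z \<equiv> {x :: real^'d. (\<forall>i. x $ i \<in> \<int>) \<and> (\<forall>i. \<bar>x $ i\<bar> \<le> real L)}"
  shows "finite Z" and "card Z \<le> (2 * L + 1) ^ CARD('d)"
proof -
  let ?f = "\<lambda>x :: real^'d. \<lambda>i. \<lfloor>x $ i\<rfloor>"
  let ?B = "PiE (UNIV :: 'd set) (\<lambda>_. {- int L..int L})"
  have inj: "inj_on ?f Z"
  proof (rule inj_onI)
    fix x y assume xy: "x \<in> Z" "y \<in> Z" "?f x = ?f y"
    have "x $ i = y $ i" for i
    proof -
      have "\<lfloor>x $ i\<rfloor> = \<lfloor>y $ i\<rfloor>" using xy(3) by meson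
      moreover have "x $ i \<in> \<int>" "y $ i \<in> \<int>" using xy by (auto simp: Z_def)
      then have "real_of_int \<lfloor>x $ i\<rfloor> = x $ i" "real_of_int \<lfloor>y $ i\<rfloor> = y $ i"
        by simp_all
      ultimately show ?thesis by metis
    qed
    then show "x = y" by (simp add: vec_eq_iff)
  qed
  have img: "?f ` Z \<subseteq> ?B"
  proof clarify
    fix x assume x: "x \<in> Z"
    have "\<lfloor>x $ i\<rfloor> \<in> {- int L..int L}" for i
    proof -
      have "real_of_int \<lfloor>x $ i\<rfloor> = x $ i" using x by (auto simp: Z_def)
      moreover have "\<bar>x $ i\<bar> \<le> real L" using x by (auto simp: Z_def)
      ultimately have "\<bar>real_of_int \<lfloor>x $ i\<rfloor>\<bar> \<le> real L" by (simp only:)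
      then have "\<bar>\<lfloor>x $ i\<rfloor>\<bar> \<le> int L" by linarith
      then show ?thesis by auto
    qed
    then show "?f x \<in> ?B" by auto
  qed
  have fin: "finite ?B" by (intro finite_PiE) auto
  show "finite Z" using inj_on_finite[OF inj img fin] .
  have "card Z \<le> card ?B" using card_inj_on_le[OF inj img fin] .
  also have "\<dots> = (2 * L + 1) ^ CARD('d)"
  proof -
    have "nat (2 * int L + 1) = Suc (2 * L)" by linarith
    then show ?thesis by (simp add: card_PiE)
  qed
  finally show "card Z \<le> (2 * L + 1) ^ CARD('d)" .
qed

lemma integer_points_of_dilates_bound:
  fixes V :: "(real^'d) set" and m :: nat
  assumes "finite V" "m > 0"
  shows "finite {x \<in> dilate (real n / real m) (convex hull V). \<forall>i. x $ i \<in> \<int>}"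
    and "\<exists>C. \<forall>n. real (card {x \<in> dilate (real n / real m) (convex hull V). \<forall>i. x $ i \<in> \<int>})
          \<le> C * real (Suc n) ^ CARD('d)"
proof -
  let ?Z = "\<lambda>n. {x \<in> dilate (real n / real m) (convex hull V). \<forall>i. x $ i \<in> \<int>}"
  let ?W = "\<lambda>L. {x :: real^'d. (\<forall>i. x $ i \<in> \<int>) \<and> (\<forall>i. \<bar>x $ i\<bar> \<le> real L)}"
  have "bounded (convex hull V)" using assms(1) by (simp add: bounded_convex_hull finite_imp_bounded)
  then obtain B where B: "\<And>y. y \<in> convex hull V \<Longrightarrow> norm y \<le> B" unfolding bounded_iff by blast
  obtain K :: nat where K: "B \<le> real K" using real_arch_simple by blast
  have sub: "?Z n \<subseteq> ?W (n * K)" for n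
  proof
    fix x assume x: "x \<in> ?Z n"
    then obtain y where y: "y \<in> convex hull V" "x = (real n / real m) *\<^sub>R y" by (auto simp: dilate_def)
    have "\<bar>x $ i\<bar> \<le> real (n * K)" for i
    proof -
      have "\<bar>x $ i\<bar> \<le> norm x" by (rule component_le_norm_cart)
      also have "\<dots> = (real n / real m) * norm y" using y by simp
      also have "\<dots> \<le> real n * real K"
      proof (rule mult_mono)
        show "real n / real m \<le> real n" using assms(2) by (simp add: divide_le_eq mult_le_cancel_left1)
        show "norm y \<le> real K" using B[OF y(1)] K by simp
      qed auto
      finally show ?thesis by simp
    qed
    then show "x \<in> ?W (n * K)" using x by auto
  qed
  show "finite (?Z n)" using finite_subset[OF sub card_integer_points_in_box(1)] .
  have "real (card (?Z n)) \<le> real (2 * K + 1) ^ CARD('d) * real (Suc n) ^ CARD('d)" for n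
  proof -
    have "card (?Z n) \<le> card (?W (n * K))" by (rule card_mono[OF card_integer_points_in_box(1) sub])
    also have "\<dots> \<le> (2 * (n * K) + 1) ^ CARD('d)" by (rule card_integer_points_in_box(2))
    also have "\<dots> \<le> ((2 * K + 1) * Suc n) ^ CARD('d)" by (intro power_mono) (auto simp: algebra_simps)
    finally have "real (card (?Z n)) \<le> real (((2 * K + 1) * Suc n) ^ CARD('d))" by (rule of_nat_mono)
    then show ?thesis by (simp only: of_nat_power of_nat_mult power_mult_distrib)
  qed
  then show "\<exists>C. \<forall>n. real (card (?Z n)) \<le> C * real (Suc n) ^ CARD('d)" by blast
qed

text \<open>
  Ehrhart's theorem for rational polytopes, as a statement on the series. Let \<open>V\<close> be a finite set of lattice
  points with convex hull \<open>m Q\<close> and \<open>S\<close> the set of all \<open>(x, n)\<close> with \<open>x\<close> an integer point of \<open>n Q\<close>. Translation by \<open>(v, m)\<close> with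
  \<open>v \<in> V\<close> preserves \<open>S\<close>. Conversely, \<open>x\<close> is a combination of \<open>V\<close> with nonnegative weights of sum
  \<open>n / m\<close>; if this sum exceeds \<open>card V\<close>, some weight is at least \<open>1\<close> and its point can
  be subtracted within \<open>S\<close>. So \<open>S\<close> is the union of the orbits of its finitely many points of height at
  most \<open>card V * m\<close>. This gives some power of \<open>1 - X\<^sup>m\<close> as denominator, and the bound
  \<open>O(n\<^sup>d)\<close> on the number of integer points in \<open>n Q\<close> lowers the exponent to \<open>d + 1\<close>.
\<close>

theorem rational_order_Ehr_Z:
  fixes Q :: "(real^'d) set" and m :: nat
  assumes "Q \<noteq> {}" "m > 0" and lattice: "lattice_polytope (dilate (real m) Q)"
  shows "rational_order m (CARD('d) + 1) (Ehr_Z Q)"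
proof -
  obtain V :: "(real^'d) set" where V: "finite V" "\<And>v i. v \<in> V \<Longrightarrow> v $ i \<in> \<int>" "dilate (real m) Q = convex hull V"
    using lattice unfolding lattice_polytope_def by blast
  have V_ne: "V \<noteq> {}" using V(3) assms(1) by (auto simp: dilate_def)
  define L where "L n = {x \<in> dilate (real n / real m) (convex hull V). \<forall>i. x $ i \<in> \<int>}" for n :: nat
  have dil: "dilate (real n) Q = dilate (real n / real m) (convex hull V)" for n :: nat
    using assms(2) by (simp add: dilate_dilate flip: V(3))
  have coeff_Ehr: "Ehr_Z Q $ n = int (card (L n))" for n
  proof (cases "n = 0")
    case True
    \<comment> \<open>The constant term \<open>1\<close> set by convention is the count for \<open>0 Q\<close>, as \<open>Q\<close> is nonempty.\<close>
    have "dilate 0 (convex hull V) = {0}" using V_ne by (auto simp: dilate_def image_constant_conv)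
    then have zero: "dilate (real 0 / real m) (convex hull V) = {0}" by simp
    have "L 0 = {x \<in> {0}. \<forall>i. x $ i \<in> \<int>}" by (simp only: L_def zero)
    also have "\<dots> = {0}" by auto
    finally have "L 0 = {0}" .
    then show ?thesis using True by (simp add: Ehr_Z_def)
  next
    case False
    then show ?thesis by (simp add: Ehr_Z_def ehr_def dil L_def)
  qed
  have finite_L: "finite (L n)" for n
    unfolding L_def by (rule integer_points_of_dilates_bound(1)[OF V(1) assms(2)])
  define S where "S = {p :: (real^'d) \<times> real. \<exists>n. snd p = real n \<and> fst p \<in> L n}"
  define G where "G = (\<lambda>v. (v, real m)) ` V"
  have L_iff: "x \<in> L n \<longleftrightarrow> (\<exists>u. (\<forall>v\<in>V. 0 \<le> u v) \<and> sum u V = real n / real m \<and> (\<Sum>v\<in>V. u v *\<^sub>R v) = x)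
      \<and> (\<forall>i. x $ i \<in> \<int>)" for x n
    unfolding L_def using dilate_convex_hull_finite[OF V(1) V_ne, of "real n / real m" x] by auto
  have sum_update: "sum (u(v := u v + c)) V = sum u V + c"
      "(\<Sum>w\<in>V. (u(v := u v + c)) w *\<^sub>R w) = (\<Sum>w\<in>V. u w *\<^sub>R w) + c *\<^sub>R v"
    if "v \<in> V" for u :: "real^'d \<Rightarrow> real" and v c
    using that by (simp_all add: sum.remove[OF V(1) that] scaleR_add_left)
  have L_add: "x + v \<in> L (n + m)" if x: "x \<in> L n" and v: "v \<in> V" for x v n
  proof -
    obtain u where u: "\<forall>v\<in>V. 0 \<le> u v" "sum u V = real n / real m" "(\<Sum>v\<in>V. u v *\<^sub>R v) = x"
      and int: "\<forall>i. x $ i \<in> \<int>" using x unfolding L_iff by blast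
    have "real (n + m) / real m = real n / real m + 1" using assms(2) by (simp add: field_simps)
    then have "(\<forall>w\<in>V. 0 \<le> (u(v := u v + 1)) w) \<and> sum (u(v := u v + 1)) V = real (n + m) / real m
        \<and> (\<Sum>w\<in>V. (u(v := u v + 1)) w *\<^sub>R w) = x + v"
      using u v by (simp only: sum_update[OF v]) simp
    moreover have "\<forall>i. (x + v) $ i \<in> \<int>" using int V(2)[OF v] by simp
    ultimately show ?thesis unfolding L_iff by blast
  qed
  have L_descend: "\<exists>v\<in>V. n \<ge> m \<and> x - v \<in> L (n - m)" if x: "x \<in> L n" and n: "n > card V * m" for x n
  proof -
    obtain u where u: "\<forall>v\<in>V. 0 \<le> u v" "sum u V = real n / real m" "(\<Sum>v\<in>V. u v *\<^sub>R v) = x"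
      and int: "\<forall>i. x $ i \<in> \<int>" using x unfolding L_iff by blast
    have "real n > real (card V) * real m" using n by (metis of_nat_less_iff of_nat_mult)
    then have "sum u V > real (card V)" using assms(2) by (simp add: u(2) field_simps)
    then obtain v where v: "v \<in> V" "u v \<ge> 1"
      using sum_bounded_above[of V u 1] by fastforce
    have "card V > 0" using V(1) V_ne by (simp add: card_gt_0_iff)
    then have nm: "n \<ge> m" using n by (cases "card V") auto
    have "real (n - m) / real m = real n / real m + - 1"
      using assms(2) nm by (simp add: field_simps of_nat_diff)
    then have "(\<forall>w\<in>V. 0 \<le> (u(v := u v + - 1)) w) \<and> sum (u(v := u v + - 1)) V = real (n - m) / real m
        \<and> (\<Sum>w\<in>V. (u(v := u v + - 1)) w *\<^sub>R w) = x - v"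
      using u v by (simp only: sum_update[OF v(1)]) simp
    moreover have "\<forall>i. (x - v) $ i \<in> \<int>" using int V(2)[OF v(1)] by simp
    ultimately show ?thesis unfolding L_iff using v(1) nm by blast
  qed
  have layer: "{p \<in> S. snd p = real n} = (\<lambda>x. (x, real n)) ` L n" for n :: nat
    by (auto simp: S_def)
  interpret graded_translations S G snd m
  proof
    fix x v assume "x \<in> S" "v \<in> G"
    then obtain n w where "snd x = real n" "fst x \<in> L n" "w \<in> V" "v = (w, real m)"
      by (auto simp: S_def G_def)
    then show "x + v \<in> S" using L_add[of "fst x" n w]
      by (auto simp: S_def intro!: exI[of _ "n + m"])
  next
    show "finite {x \<in> S. snd x = real n}" for n :: nat unfolding layer using finite_L by blast
  qed (auto simp: G_def S_def)
  have series: "counting_series snd S = Ehr_Z Q"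
    by (simp add: fps_eq_iff counting_series_def layer coeff_Ehr card_image inj_on_def)
  obtain vs where vs: "set vs = G" using finite_list[of G] V(1) by (auto simp: G_def)
  define B where "B = {p \<in> S. snd p \<le> real (card V * m)}"
  have "B \<subseteq> (\<Union>n\<le>card V * m. {p \<in> S. snd p = real n})"
    by (auto simp: B_def S_def simp del: of_nat_mult)
  then have finite_B: "finite B" by (rule finite_subset) (auto intro: finite_layer)
  have closed_S: "translation_closed vs S" using closed vs by (auto simp: translation_closed_def)
  have "S = (\<Union>b\<in>B. orbit vs b)"
  proof
    show "(\<Union>b\<in>B. orbit vs b) \<subseteq> S" using orbit_subset[OF closed_S] by (auto simp: B_def)
    have "x \<in> L n \<Longrightarrow> (x, real n) \<in> (\<Union>b\<in>B. orbit vs b)" for x n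
    proof (induction n arbitrary: x rule: less_induct)
      case (less n)
      show ?case
      proof (cases "n > card V * m")
        case False
        then have "(x, real n) \<in> B" using less.prems
          by (auto simp: B_def S_def simp del: of_nat_mult)
        then show ?thesis using base_in_orbit by blast
      next
        case True
        then obtain v where v: "v \<in> V" "n \<ge> m" "x - v \<in> L (n - m)"
          using L_descend less.prems by blast
        then obtain b where b: "b \<in> B" "(x - v, real (n - m)) \<in> orbit vs b"
          using less.IH[of "n - m" "x - v"] assms(2) by auto
        have "(v, real m) \<in> set vs" using v(1) vs by (simp add: G_def)
        then have "(x - v, real (n - m)) + (v, real m) \<in> orbit vs b"
          using orbit_closed[of vs b] b(2) unfolding translation_closed_def by blast
        then show ?thesis using b(1) v(2) by auto
      qed
    qed
    then show "S \<subseteq> (\<Union>b\<in>B. orbit vs b)" by (auto simp: S_def)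
  qed
  moreover have "rational_order m (length vs) (counting_series snd (\<Union>b\<in>B. orbit vs b))"
    using rational_order_finite_union[of vs B] vs finite_B by (auto simp: B_def)
  ultimately have rat: "rational_order m (length vs) (Ehr_Z Q)" using series by simp
  obtain C where "\<And>n. real (card (L n)) \<le> C * real (Suc n) ^ CARD('d)"
    using integer_points_of_dilates_bound(2)[OF V(1) assms(2)] unfolding L_def by blast
  then have "\<bar>real_of_int (Ehr_Z Q $ n)\<bar> \<le> C * real (Suc n) ^ CARD('d)" for n
    by (simp add: coeff_Ehr)
  then show ?thesis using rational_order_of_growth[OF assms(2) _ rat] by blast
qed

section \<open>Extracting the terms with integer exponent\<close>

text \<open>
  On series in \<open>s = t\<^bsup>1/r\<^esup>\<close> this is the operator \<open>Int\<close>, with the result written in \<open>t\<close>.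
\<close>

definition fps_section :: "nat \<Rightarrow> 'a::zero fps \<Rightarrow> 'a fps" where
  "fps_section r f = Abs_fps (\<lambda>n. f $ (r * n))"

text \<open>
  The operator \<open>Int\<close> is linear over series in \<open>t = s\<^sup>r\<close>, hence passes through the denominator.
\<close>

lemma fps_section_mult:
  fixes f :: "'a::comm_ring_1 fps"
  assumes "r > 0"
  shows "fps_section r (f * (1 - fps_X ^ (r * k)) ^ N) = fps_section r f * (1 - fps_X ^ k) ^ N"
proof (induction N)
  case (Suc N)
  have step: "fps_section r (g * (1 - fps_X ^ (r * k))) = fps_section r g * (1 - fps_X ^ k)"
    for g :: "'a fps"
    using assms
    by (simp add: fps_eq_iff fps_section_def right_diff_distrib fps_X_power_mult_right_nth
      flip: right_diff_distrib')
  show ?case using step[of "f * (1 - fps_X ^ (r * k)) ^ N"] Suc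
    by (simp only: power_Suc2 mult.assoc[symmetric])
qed simp

lemma coeff_Int_part:
  assumes "r > 0"
  shows "coeff (Int_part r h) n = coeff h (r * n)"
proof -
  let ?I = "{i. i \<le> degree h \<and> r dvd i}"
  have "coeff (Int_part r h) n = (\<Sum>i\<in>?I. if i = r * n then coeff h i else 0)"
    unfolding Int_part_def coeff_sum using assms by (intro sum.cong) auto
  also have "\<dots> = (if r * n \<in> ?I then coeff h (r * n) else 0)"
    by (subst sum.delta) auto
  also have "\<dots> = coeff h (r * n)" by (auto simp: coeff_eq_0)
  finally show ?thesis .
qed

lemma fps_of_poly_Int_part:
  assumes "r > 0"
  shows "fps_of_poly (Int_part r h) = fps_section r (fps_of_poly h)"
  using assms by (simp add: fps_eq_iff coeff_Int_part fps_section_def)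

text \<open>
  The definite descriptions that define the numerator polynomials denote something only because the
  product on the right is a polynomial, which is what Ehrhart's theorem supplies.
\<close>

lemma fps_of_poly_the:
  assumes "rational_order m N f"
  shows "fps_of_poly (THE h. fps_of_poly h = f * (1 - fps_X ^ m) ^ N) = f * (1 - fps_X ^ m) ^ N"
proof -
  obtain p where "f * (1 - fps_X ^ m) ^ N = fps_of_poly p"
    using assms unfolding rational_order_def by blast
  then show ?thesis by (simp add: fps_of_poly_eq_iff)
qed

text \<open>
  A rational Ehrhart series is the integral Ehrhart series of a shrunken polytope, so the rational and
  the refined case need no separate form of Ehrhart's theorem.
\<close>

lemma Ehr_Q_eq_Ehr_Z: "Ehr_Q P r = Ehr_Z (dilate (1 / real r) P)"
  by (simp add: Ehr_Q_def Ehr_Z_def ehr_def dilate_dilate fps_eq_iff)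

lemma fps_section_Ehr_Q:
  assumes "r > 0"
  shows "fps_section r (Ehr_Q P r) = Ehr_Z P"
  using assms by (simp add: fps_section_def Ehr_Q_def Ehr_Z_def fps_eq_iff)

lemma hstar_Q_ref_eq: "hstar_Q_ref P r m = hstar_Q P (2 * r) m"
proof -
  have "Ehr_Q_ref P r = Ehr_Q P (2 * r)"
    by (simp add: Ehr_Q_ref_def Ehr_Q_def fps_eq_iff)
  then show ?thesis by (simp add: hstar_Q_ref_def hstar_Q_def)
qed

text \<open>
  When \<open>m = r k\<close>, both numerators come from the same series: applying \<open>Int\<close> to
  \<open>Ehr\<^sub>Q (1 - t\<^bsup>m/r\<^esup>)\<^bsup>d+1\<^esup>\<close> yields \<open>Ehr\<^sub>Z (1 - t\<^sup>k)\<^bsup>d+1\<^esup>\<close>, while \<open>hstar_Z\<close> is normalised by the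
  denominator of \<open>P\<close> in place of \<open>k\<close>. The second identity clears the two powers against each other,
  and the first is the case in which they agree.
\<close>

lemma hstar_Z_eq_Int_part_hstar_Q:
  fixes P :: "(real^'d) set"
  assumes "P \<noteq> {}" "r > 0" "m > 0" and lattice: "lattice_polytope (dilate (real m / real r) P)"
    and "real m / real r \<in> \<int>"
  shows "real m / real r = real (denominator P) \<Longrightarrow> hstar_Z P = Int_part r (hstar_Q P r m)"
    and "hstar_Z P * (1 - monom 1 (m div r)) ^ (CARD('d) + 1)
              = Int_part r (hstar_Q P r m) * (1 - monom 1 (denominator P)) ^ (CARD('d) + 1)"
proof -
  let ?N = "CARD('d) + 1"
  define k where "k = m div r"
  have m: "m = r * k"
  proof -
    obtain z where "real m / real r = real_of_int z" using assms(5) by (auto elim: Ints_cases)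
    then have "real_of_int (int m) = real_of_int (int r * z)" using assms(2) by (simp add: field_simps)
    then have "int m = int r * z" by (simp only: of_int_eq_iff)
    then have "r dvd m" by (metis dvd_triv_left int_dvd_int_iff)
    then show ?thesis by (simp add: k_def)
  qed
  have k: "k > 0" "real m / real r = real k" using m assms(2,3) by auto
  have "denominator P > 0 \<and> lattice_polytope (dilate (real (denominator P)) P)"
    unfolding denominator_def by (rule LeastI[of _ k]) (use k lattice in auto)
  then have Z: "fps_of_poly (hstar_Z P) = Ehr_Z P * (1 - fps_X ^ denominator P) ^ ?N"
    unfolding hstar_Z_def using assms(1) by (intro fps_of_poly_the rational_order_Ehr_Z) auto
  have "rational_order m ?N (Ehr_Q P r)"
    unfolding Ehr_Q_eq_Ehr_Z using assms(1,3) lattice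
    by (intro rational_order_Ehr_Z) (auto simp: dilate_dilate, simp add: dilate_def)
  then have "fps_of_poly (hstar_Q P r m) = Ehr_Q P r * (1 - fps_X ^ m) ^ ?N"
    unfolding hstar_Q_def by (rule fps_of_poly_the)
  then have Q: "fps_of_poly (Int_part r (hstar_Q P r m)) = Ehr_Z P * (1 - fps_X ^ k) ^ ?N"
    unfolding fps_of_poly_Int_part[OF assms(2)] m
    by (simp only: fps_section_mult[OF assms(2)] fps_section_Ehr_Q[OF assms(2)])
  show "hstar_Z P = Int_part r (hstar_Q P r m)" if "real m / real r = real (denominator P)"
  proof -
    have "denominator P = k" using that k(2) by simp
    then show ?thesis using Z Q by (simp only: fps_of_poly_eq_iff[symmetric])
  qed
  have "fps_of_poly (hstar_Z P * (1 - monom 1 k) ^ ?N)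
      = fps_of_poly (Int_part r (hstar_Q P r m) * (1 - monom 1 (denominator P)) ^ ?N)"
    unfolding fps_of_poly_mult fps_of_poly_power fps_of_poly_diff fps_of_poly_monom' fps_of_poly_1 Z Q
    by (simp only: mult_ac)
  then show "hstar_Z P * (1 - monom 1 (m div r)) ^ ?N
      = Int_part r (hstar_Q P r m) * (1 - monom 1 (denominator P)) ^ ?N"
    by (simp only: fps_of_poly_eq_iff k_def)
qed

lemma codenominator_pos:
  assumes "has_codenominator P r"
  shows "r > 0"
proof -
  obtain n :: nat and b where r: "int r = Lcm {b i | i. i < n \<and> b i \<noteq> 0}"
    using assms unfolding has_codenominator_def by blast
  have "Lcm {b i | i. i < n \<and> b i \<noteq> 0} \<noteq> 0" by (subst Lcm_0_iff) auto
  then show ?thesis using r by (cases r) auto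
qed

theorem corollary14:
  fixes P :: "(real^'d) set" and r :: nat
  assumes "rational_polytope P"
    and "aff_dim P = int CARD('d)"
    and "has_codenominator P r"
  shows "(\<forall>m::nat. m > 0 \<and> lattice_polytope (dilate (real m / real r) P)
            \<and> real m / real r \<in> \<int> \<longrightarrow>
            (real m / real r = real (denominator P) \<longrightarrow>
               hstar_Z P = Int_part r (hstar_Q P r m)) \<and>
            hstar_Z P * (1 - monom 1 (m div r)) ^ (CARD('d) + 1)
              = Int_part r (hstar_Q P r m) * (1 - monom 1 (denominator P)) ^ (CARD('d) + 1))
       \<and> (\<forall>m::nat. m > 0 \<and> lattice_polytope (dilate (real m / (2 * real r)) P)
            \<and> real m / (2 * real r) \<in> \<int> \<longrightarrow>
            (real m / (2 * real r) = real (denominator P) \<longrightarrow>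
               hstar_Z P = Int_part (2 * r) (hstar_Q_ref P r m)) \<and>
            hstar_Z P * (1 - monom 1 (m div (2 * r))) ^ (CARD('d) + 1)
              = Int_part (2 * r) (hstar_Q_ref P r m) * (1 - monom 1 (denominator P)) ^ (CARD('d) + 1))"
proof -
  have P: "P \<noteq> {}" using assms(2) by auto
  have r: "r > 0" "2 * r > 0" using codenominator_pos[OF assms(3)] by auto
  have two_r: "2 * real r = real (2 * r)" by simp
  show ?thesis
    unfolding hstar_Q_ref_eq two_r
    using hstar_Z_eq_Int_part_hstar_Q[OF P r(1)] hstar_Z_eq_Int_part_hstar_Q[OF P r(2)] by blast
qed

end
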